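(* Modularity optimization satisfies the Richness axiom, but violates each of the Standard Consistency, Refinement Consistency, Inter-edge Consistency, Connectivity, Pair-of-Cliques and Fixed Point axioms.
   Context: A network is a finite simple undirected unweighted graph $N=(V,E)$. A clustering of $N$ is a partition of $V$ into nonempty clusters; for $S\subseteq V$, $N[S]$ is the induced subgraph. An admissible clustering (for Modularity) is one in which every cluster induces a connected subgraph of $N$. For $E\neq\emptyset$, the Modularity score of a clustering $\mathcal{C}$ is $\sum_{c\in\mathcal{C}}\left[\frac{e_c}{|E|}-\left(\frac{d_c}{2|E|}\right)^2\right]$, where $e_c$ is the number of edges with both endpoints in $c$ and $d_c$ is the sum over $v\in c$ of the degree of $v$ in $N$. $\mathrm{Opt}(N)$ is the set of admissible clusterings of maximum Modularity score (if $E=\emptyset$ the only admissible clustering is the partition into singletons, which is regarded as the optimal one). The axioms are interpreted via $\mathrm{Opt}$: Richness: for every finite $V$ and every partition $\Gamma$ of $V$ there is an edge set $E$ on $V$ with $\mathrm{Opt}((V,E))=\{\Gamma\}$. For a clustering $\Gamma$ of $N=(V,E)$, $N'=(V,E')$ is a $\Gamma$-consistent modification if $E'$ is obtained from $E$ by deleting some edges between different clusters of $\Gamma$ and/or adding some edges with both endpoints in the same cluster of $\Gamma$; a $\Gamma$-inter-edge deletion if only deletions of edges between different clusters are made. Standard Consistency: for all $N$, $\Gamma\in\mathrm{Opt}(N)$ and $\Gamma$-consistent modifications $N'$, $\Gamma\in\mathrm{Opt}(N')$. Refinement Consistency: for all such $N,\Gamma,N'$, some clustering in $\mathrm{Opt}(N')$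 has every cluster contained in a cluster of $\Gamma$. Inter-edge Consistency: for all $N$, $\Gamma\in\mathrm{Opt}(N)$ and $\Gamma$-inter-edge deletions $N'$, $\Gamma\in\mathrm{Opt}(N')$. Connectivity: there is a non-negative non-decreasing $f:\mathbb{R}^+\to\mathbb{R}^+$ with $f(x)\to\infty$ such that for all $N$, $\Gamma\in\mathrm{Opt}(N)$ and $c\in\Gamma$ with $|c|\ge2$, the minimum number of edges of $N[c]$ whose removal disconnects $N[c]$ is strictly greater than $f(|c|)$. Pair-of-Cliques: a pair-of-cliques component is a connected component with vertex set $A\cup B$, $A\cap B=\emptyset$, $|A|=|B|=n$, $A,B$ cliques, exactly one edge between $A$ and $B$; size $2n$. The axiom holds if there is $n_0$ such that for every $N$ and every pair-of-cliques component of size $\ge n_0$, every $\Gamma\in\mathrm{Opt}(N)$ has $A$ and $B$ as clusters. Fixed Point: for all $N$, $\Gamma\in\mathrm{Opt}(N)$ and nonempty $\mathcal{D}\subseteq\Gamma$, $\mathcal{D}\in\mathrm{Opt}(N[\bigcup\mathcal{D}])$. Violating an axiom means not satisfying it. *)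

theory Defs
  imports Complex_Main "HOL-Library.Disjoint_Sets"
begin

type_synonym 'a network = "'a set \<times> 'a set set"

abbreviation verts :: "'a network \<Rightarrow> 'a set" where
  "verts N \<equiv> fst N"

abbreviation edges :: "'a network \<Rightarrow> 'a set set" where
  "edges N \<equiv> snd N"

definition network :: "'a network \<Rightarrow> bool" where
  "network N \<longleftrightarrow> finite (verts N) \<and> (\<forall>e\<in>edges N. e \<subseteq> verts N \<and> card e = 2)"

definition induced :: "'a network \<Rightarrow> 'a set \<Rightarrow> 'a network" where
  "induced N S = (S, {e \<in> edges N. e \<subseteq> S})"

definition reach :: "'a network \<Rightarrow> ('a \<times> 'a) set" where
  "reach N = {(u, v). {u, v} \<in> edges N}\<^sup>*"

definition is_connected :: "'a network \<Rightarrow> bool" where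
  "is_connected N \<longleftrightarrow> (\<forall>u\<in>verts N. \<forall>v\<in>verts N. (u, v) \<in> reach N)"

definition components :: "'a network \<Rightarrow> 'a set set" where
  "components N = (\<lambda>u. {v \<in> verts N. (u, v) \<in> reach N}) ` verts N"

definition degree :: "'a network \<Rightarrow> 'a \<Rightarrow> nat" where
  "degree N v = card {e \<in> edges N. v \<in> e}"

text \<open>Only meaningful for networks with at least two vertices; otherwise no set of edges
  disconnects the network.\<close>

definition edge_connectivity :: "'a network \<Rightarrow> nat" where
  "edge_connectivity N =
     Min (card ` {F. F \<subseteq> edges N \<and> \<not> is_connected (verts N, edges N - F)})"


definition admissible :: "'a network \<Rightarrow> 'a set set \<Rightarrow> bool" where
  "admissible N \<C> \<longleftrightarrow>
     partition_on (verts N) \<C> \<and> (\<forall>c\<in>\<C>. is_connected (induced N c))"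

definition modularity :: "'a network \<Rightarrow> 'a set set \<Rightarrow> real" where
  "modularity N \<C> =
     (\<Sum>c\<in>\<C>. real (card {e \<in> edges N. e \<subseteq> c}) / real (card (edges N))
             - (real (\<Sum>v\<in>c. degree N v) / (2 * real (card (edges N))))\<^sup>2)"

text \<open>A network without edges needs no separate case: every score is then \<open>0\<close> (division by
  zero), and the partition into singletons is the only admissible clustering; see
  \<open>modularity_opt_no_edges\<close> below.\<close>

definition modularity_opt :: "'a network \<Rightarrow> 'a set set set" where
  "modularity_opt N =
     {\<C>. admissible N \<C> \<and> (\<forall>\<D>. admissible N \<D> \<longrightarrow> modularity N \<D> \<le> modularity N \<C>)}"

lemma admissible_no_edges:
  "admissible (V, {}) \<C> \<longleftrightarrow> \<C> = (\<lambda>v. {v}) ` V"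
proof
  assume a: "admissible (V, {}) \<C>"
  have part: "partition_on V \<C>"
    using a by (simp add: admissible_def)
  have single: "c = {v}" if "c \<in> \<C>" "v \<in> c" for c v
    using a that
    by (auto simp: admissible_def is_connected_def induced_def reach_def)
  show "\<C> = (\<lambda>v. {v}) ` V"
  proof (intro equalityI subsetI)
    fix c assume c: "c \<in> \<C>"
    then obtain v where "v \<in> c"
      using part by (metis all_not_in_conv partition_onD3)
    with c single part show "c \<in> (\<lambda>v. {v}) ` V"
      by (metis UnionI imageI partition_onD1)
  next
    fix c assume "c \<in> (\<lambda>v. {v}) ` V"
    with single part show "c \<in> \<C>"
      by (auto simp: partition_on_def)
  qed
next
  assume "\<C> = (\<lambda>v. {v}) ` V"
  then show "admissible (V, {}) \<C>"
    by (auto simp: admissible_def is_connected_def induced_def reach_def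
        partition_on_def disjoint_def)
qed

lemma modularity_opt_no_edges:
  "modularity_opt (V, {}) = {(\<lambda>v. {v}) ` V}"
  by (auto simp: modularity_opt_def admissible_no_edges)


definition inter_edge :: "'a set set \<Rightarrow> 'a set \<Rightarrow> bool" where
  "inter_edge \<Gamma> e \<longleftrightarrow> (\<exists>c\<in>\<Gamma>. \<exists>d\<in>\<Gamma>. c \<noteq> d \<and> (\<exists>u\<in>c. \<exists>v\<in>d. e = {u, v}))"

definition intra_edge :: "'a set set \<Rightarrow> 'a set \<Rightarrow> bool" where
  "intra_edge \<Gamma> e \<longleftrightarrow> (\<exists>c\<in>\<Gamma>. \<exists>u\<in>c. \<exists>v\<in>c. u \<noteq> v \<and> e = {u, v})"

definition consistent_modification :: "'a set set \<Rightarrow> 'a network \<Rightarrow> 'a network \<Rightarrow> bool" where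
  "consistent_modification \<Gamma> N N' \<longleftrightarrow>
     verts N' = verts N \<and>
     (\<exists>D A. D \<subseteq> {e \<in> edges N. inter_edge \<Gamma> e} \<and> A \<subseteq> {e. intra_edge \<Gamma> e} \<and>
            edges N' = (edges N - D) \<union> A)"

definition inter_edge_deletion :: "'a set set \<Rightarrow> 'a network \<Rightarrow> 'a network \<Rightarrow> bool" where
  "inter_edge_deletion \<Gamma> N N' \<longleftrightarrow>
     verts N' = verts N \<and>
     (\<exists>D. D \<subseteq> {e \<in> edges N. inter_edge \<Gamma> e} \<and> edges N' = edges N - D)"

definition pair_of_cliques :: "'a network \<Rightarrow> 'a set \<Rightarrow> 'a set \<Rightarrow> nat \<Rightarrow> bool" where
  "pair_of_cliques N A B n \<longleftrightarrow>
     A \<union> B \<in> components N \<and> A \<inter> B = {} \<and> card A = n \<and> card B = n \<and>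
     (\<forall>u\<in>A. \<forall>v\<in>A. u \<noteq> v \<longrightarrow> {u, v} \<in> edges N) \<and>
     (\<forall>u\<in>B. \<forall>v\<in>B. u \<noteq> v \<longrightarrow> {u, v} \<in> edges N) \<and>
     card {e \<in> edges N. \<exists>u\<in>A. \<exists>v\<in>B. e = {u, v}} = 1"


text \<open>The axioms are properties of a map \<open>Opt\<close> assigning to each network its set of optimal
  clusterings.\<close>

definition richness :: "('a network \<Rightarrow> 'a set set set) \<Rightarrow> bool" where
  "richness Opt \<longleftrightarrow>
     (\<forall>V \<Gamma>. finite V \<and> partition_on V \<Gamma> \<longrightarrow> (\<exists>E. network (V, E) \<and> Opt (V, E) = {\<Gamma>}))"

definition standard_consistency :: "('a network \<Rightarrow> 'a set set set) \<Rightarrow> bool" where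
  "standard_consistency Opt \<longleftrightarrow>
     (\<forall>N \<Gamma> N'. network N \<and> \<Gamma> \<in> Opt N \<and> consistent_modification \<Gamma> N N' \<longrightarrow> \<Gamma> \<in> Opt N')"

definition refinement_consistency :: "('a network \<Rightarrow> 'a set set set) \<Rightarrow> bool" where
  "refinement_consistency Opt \<longleftrightarrow>
     (\<forall>N \<Gamma> N'. network N \<and> \<Gamma> \<in> Opt N \<and> consistent_modification \<Gamma> N N' \<longrightarrow>
        (\<exists>\<Gamma>'\<in>Opt N'. \<forall>c'\<in>\<Gamma>'. \<exists>c\<in>\<Gamma>. c' \<subseteq> c))"

definition inter_edge_consistency :: "('a network \<Rightarrow> 'a set set set) \<Rightarrow> bool" where
  "inter_edge_consistency Opt \<longleftrightarrow>
     (\<forall>N \<Gamma> N'. network N \<and> \<Gamma> \<in> Opt N \<and> inter_edge_deletion \<Gamma> N N' \<longrightarrow> \<Gamma> \<in> Opt N')"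

definition connectivity :: "('a network \<Rightarrow> 'a set set set) \<Rightarrow> bool" where
  "connectivity Opt \<longleftrightarrow>
     (\<exists>f :: real \<Rightarrow> real.
        (\<forall>x>0. f x \<ge> 0) \<and> mono_on {0<..} f \<and> filterlim f at_top at_top \<and>
        (\<forall>N \<Gamma> c. network N \<and> \<Gamma> \<in> Opt N \<and> c \<in> \<Gamma> \<and> card c \<ge> 2 \<longrightarrow>
           real (edge_connectivity (induced N c)) > f (real (card c))))"

definition pair_of_cliques_axiom :: "('a network \<Rightarrow> 'a set set set) \<Rightarrow> bool" where
  "pair_of_cliques_axiom Opt \<longleftrightarrow>
     (\<exists>n\<^sub>0. \<forall>N A B n. network N \<and> pair_of_cliques N A B n \<and> 2 * n \<ge> n\<^sub>0 \<longrightarrow>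
        (\<forall>\<Gamma>\<in>Opt N. A \<in> \<Gamma> \<and> B \<in> \<Gamma>))"

definition fixed_point :: "('a network \<Rightarrow> 'a set set set) \<Rightarrow> bool" where
  "fixed_point Opt \<longleftrightarrow>
     (\<forall>N \<Gamma> \<D>. network N \<and> \<Gamma> \<in> Opt N \<and> \<D> \<subseteq> \<Gamma> \<and> \<D> \<noteq> {} \<longrightarrow>
        \<D> \<in> Opt (induced N (\<Union>\<D>)))"

end

theory Submission
  imports Defs
begin

text \<open>
  For richness, take a clique on every cluster of \<open>\<Gamma>\<close> and no other edges: clusters cannot be merged
  because they must be connected, and the score per vertex grows with the part of a clique that a
  cluster covers.

  The partition of the hexagon into three disjoint edges is optimal, although not uniquely. Deleting
  one of the remaining edges turns the hexagon into a path, whose halves score \<open>3 / 10\<close>, while no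
  refinement of the three pairs scores more than \<open>13 / 50\<close>. So merging is forced, which refutes all
  three consistency axioms.

  Merging two adjacent clusters \<open>c\<close>, \<open>d\<close> changes the score by at least
  \<open>1 / |E| - d\<^sub>c d\<^sub>d / (2 |E|\<^sup>2)\<close>, hence every component \<open>K\<close> with \<open>d\<^sub>K\<^sup>2 < 2 |E|\<close> is a single cluster.
  Next to a large star, a pair of cliques is such a component; it has edge connectivity one, and for
  cliques of size two it would be split if it were the whole network. This refutes the remaining
  three axioms.
\<close>

section \<open>Scores of single clusters, reachability and connectedness\<close>

definition cluster_score :: "'a network \<Rightarrow> 'a set \<Rightarrow> real" where
  "cluster_score N c =
     real (card {e \<in> edges N. e \<subseteq> c}) / real (card (edges N))
       - (real (\<Sum>v\<in>c. degree N v) / (2 * real (card (edges N))))\<^sup>2"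

lemma modularity_cluster_score: "modularity N \<C> = (\<Sum>c\<in>\<C>. cluster_score N c)"
  by (simp add: modularity_def cluster_score_def)

text \<open>The weights of the clusters of any partition add up to the same total, so vertex weights
  act as a dual certificate: an upper bound on the modularity follows without enumerating
  partitions.\<close>

lemma modularity_le_sum_weights:
  assumes "finite V" "partition_on V \<C>"
    and "\<And>c. c \<in> \<C> \<Longrightarrow> cluster_score N c \<le> sum w c"
  shows "modularity N \<C> \<le> sum w V"
  unfolding modularity_cluster_score sum.partition[OF assms(1,2), of w]
  using assms(3) by (rule sum_mono)

lemma reach_closed:
  assumes "(u, v) \<in> reach N" "u \<in> S"
    and "\<And>x y. {x, y} \<in> edges N \<Longrightarrow> x \<in> S \<Longrightarrow> y \<in> S"
  shows "v \<in> S"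
  using assms(1) unfolding reach_def
  by (induction rule: rtrancl_induct) (use assms(2,3) in auto)

lemma reach_edge: "{u, v} \<in> edges N \<Longrightarrow> (u, v) \<in> reach N"
  by (auto simp: reach_def)

lemma reach_refl: "(u, u) \<in> reach N"
  by (simp add: reach_def)

lemma reach_trans: "(u, v) \<in> reach N \<Longrightarrow> (v, w) \<in> reach N \<Longrightarrow> (u, w) \<in> reach N"
  by (auto simp: reach_def intro: rtrancl_trans)

lemma reach_sym:
  assumes "(u, v) \<in> reach N"
  shows "(v, u) \<in> reach N"
proof -
  have "sym ({(u, v). {u, v} \<in> edges N}\<^sup>*)"
    by (intro sym_rtrancl) (auto simp: sym_def insert_commute)
  with assms show ?thesis
    by (auto simp: reach_def dest: symD)
qed

lemma reach_mono: "edges N \<subseteq> edges N' \<Longrightarrow> (u, v) \<in> reach N \<Longrightarrow> (u, v) \<in> reach N'"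
  unfolding reach_def by (rule subsetD[OF rtrancl_mono]) auto

lemma is_connectedI:
  assumes "\<And>v. v \<in> verts N \<Longrightarrow> (u, v) \<in> reach N"
  shows "is_connected N"
  using assms by (auto simp: is_connected_def intro: reach_trans reach_sym)

lemma network_finite_edges: "network N \<Longrightarrow> finite (edges N)"
  by (rule finite_subset[of _ "Pow (verts N)"]) (auto simp: network_def)

text \<open>Every count becomes a sum of indicators over the fixed sets of vertices and edges. In a
  concrete graph the score of a variable cluster \<open>c\<close> then evaluates after case splits
  on the membership of single vertices.\<close>

lemma cluster_score_of_bool:
  assumes "network N" "c \<subseteq> verts N"
  shows "cluster_score N c =
    (\<Sum>e\<in>edges N. of_bool (e \<subseteq> c)) / real (card (edges N))
      - ((\<Sum>v\<in>verts N. of_bool (v \<in> c) * (\<Sum>e\<in>edges N. of_bool (v \<in> e)))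
          / (2 * real (card (edges N))))\<^sup>2"
proof -
  have fin: "finite (edges N)" "finite (verts N)"
    using assms by (auto simp: network_finite_edges network_def)
  have count: "real (card {e \<in> edges N. P e}) = (\<Sum>e\<in>edges N. of_bool (P e))" for P
    using fin by (simp add: Collect_conj_eq)
  have "(\<Sum>v\<in>verts N. of_bool (v \<in> c) * real (degree N v)) = (\<Sum>v\<in>c. real (degree N v))"
    using fin assms(2) by (intro sum.mono_neutral_cong_right) auto
  then show ?thesis
    unfolding cluster_score_def of_nat_sum by (simp only: degree_def count)
qed

lemmas graph_score_simps = doubleton_eq_iff of_bool_def power2_eq_square


section \<open>Richness\<close>

definition cliques :: "'a set set \<Rightarrow> 'a network" where
  "cliques \<Gamma> = (\<Union>\<Gamma>, {e. card e = 2 \<and> (\<exists>g\<in>\<Gamma>. e \<subseteq> g)})"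

lemma network_cliques: "finite (\<Union>\<Gamma>) \<Longrightarrow> network (cliques \<Gamma>)"
  by (auto simp: cliques_def network_def)

lemma is_connected_clique:
  assumes "\<And>u v. u \<in> c \<Longrightarrow> v \<in> c \<Longrightarrow> u \<noteq> v \<Longrightarrow> {u, v} \<in> edges N"
  shows "is_connected (induced N c)"
proof -
  have "(u, v) \<in> reach (induced N c)" if "u \<in> c" "v \<in> c" for u v
    using that assms by (cases "u = v") (auto simp: reach_refl induced_def intro!: reach_edge)
  then show ?thesis
    by (auto simp: is_connected_def induced_def)
qed

text \<open>No edge leaves a block of \<open>\<Gamma>\<close>, so a connected cluster cannot leave
  the block of any of its vertices.\<close>

lemma admissible_cliques_refines:
  assumes \<Gamma>: "partition_on (\<Union>\<Gamma>) \<Gamma>" and \<C>: "admissible (cliques \<Gamma>) \<C>" and c: "c \<in> \<C>"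
  shows "\<exists>g\<in>\<Gamma>. c \<subseteq> g"
proof -
  obtain u where u: "u \<in> c"
    using \<C> c by (metis admissible_def all_not_in_conv partition_onD3)
  moreover have "c \<subseteq> \<Union>\<Gamma>"
    using \<C> c by (auto simp: admissible_def partition_on_def cliques_def)
  ultimately obtain g where g: "g \<in> \<Gamma>" "u \<in> g"
    by blast
  have "v \<in> g" if "v \<in> c" for v
  proof (rule reach_closed)
    show "(u, v) \<in> reach (induced (cliques \<Gamma>) c)"
      using \<C> c u that by (auto simp: admissible_def is_connected_def induced_def)
    show "y \<in> g" if "{x, y} \<in> edges (induced (cliques \<Gamma>) c)" "x \<in> g" for x y
      using that g \<Gamma> by (auto simp: induced_def cliques_def partition_on_def disjoint_def)
  qed (fact g)
  with g show ?thesis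
    by blast
qed

lemma
  assumes \<Gamma>: "finite (\<Union>\<Gamma>)" "partition_on (\<Union>\<Gamma>) \<Gamma>" and g: "g \<in> \<Gamma>"
  shows card_edges_cliques_within: "c \<subseteq> g \<Longrightarrow> card {e \<in> edges (cliques \<Gamma>). e \<subseteq> c} = card c choose 2"
    and degree_cliques: "v \<in> g \<Longrightarrow> degree (cliques \<Gamma>) v = card g - 1"
proof -
  have fin: "finite g"
    using g \<Gamma>(1) by (auto intro: finite_subset)
  {
    assume "c \<subseteq> g"
    then have "{e \<in> edges (cliques \<Gamma>). e \<subseteq> c} = {e. e \<subseteq> c \<and> card e = 2}"
      using g by (auto simp: cliques_def)
    then show "card {e \<in> edges (cliques \<Gamma>). e \<subseteq> c} = card c choose 2"
      using \<open>c \<subseteq> g\<close> fin by (simp add: n_subsets finite_subset)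
  }
  {
    assume v: "v \<in> g"
    have "{e \<in> edges (cliques \<Gamma>). v \<in> e} = (\<lambda>u. {v, u}) ` (g - {v})" (is "?L = ?R")
    proof
      show "?L \<subseteq> ?R"
      proof
        fix e assume "e \<in> ?L"
        then obtain h where h: "h \<in> \<Gamma>" "e \<subseteq> h" "card e = 2" "v \<in> e"
          by (auto simp: cliques_def)
        then have "h = g"
          using g v \<Gamma>(2) by (auto simp: partition_on_def disjoint_def)
        moreover obtain u where "e = {v, u}" "u \<noteq> v"
          using h(3,4) by (auto simp: card_2_iff)
        ultimately show "e \<in> ?R"
          using h(2) by auto
      qed
      show "?R \<subseteq> ?L"
        using g v by (auto simp: cliques_def card_2_iff)
    qed
    moreover have "inj_on (\<lambda>u. {v, u}) (g - {v})"
      by (auto simp: inj_on_def doubleton_eq_iff)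
    ultimately show "degree (cliques \<Gamma>) v = card g - 1"
      using v fin by (simp add: degree_def card_image)
  }
qed

lemma real_choose_two: "real (n choose 2) = real n * (real n - 1) / 2"
  by (cases n) (auto simp: choose_two real_of_nat_div algebra_simps)

text \<open>Within a clique of \<open>n\<close> vertices the score of a part of size \<open>k\<close>, divided by \<open>k\<close>, increases
  strictly with \<open>k\<close>, because \<open>(n - 1)\<^sup>2 < n (n - 1) \<le> 2 |E|\<close>.\<close>

lemma cluster_score_part_of_clique:
  assumes \<Gamma>: "finite (\<Union>\<Gamma>)" "partition_on (\<Union>\<Gamma>) \<Gamma>" and g: "g \<in> \<Gamma>"
    and c: "c \<subset> g" "c \<noteq> {}"
  shows "cluster_score (cliques \<Gamma>) c < real (card c) * (cluster_score (cliques \<Gamma>) g / real (card g))"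
proof -
  define k n m where "k = real (card c)" and "n = real (card g)"
    and "m = real (card (edges (cliques \<Gamma>)))"
  have fin: "finite g" "finite c"
    using g c(1) \<Gamma>(1) by (auto intro: finite_subset[OF Union_upper] dest: psubset_imp_subset finite_subset)
  \<comment> \<open>A proper nonempty part forces a block of at least two vertices. Hence the strict
    inequality below and, with it, \<open>m > 0\<close>: an edgeless network, where the divisions
    would degenerate, cannot occur here.\<close>
  have "card c \<ge> 1" "card c < card g"
    using fin c by (auto simp: Suc_le_eq card_gt_0_iff psubset_card_mono)
  then have kn: "1 \<le> k" "k < n" "2 \<le> n"
    by (auto simp: k_def n_def)
  have score: "cluster_score (cliques \<Gamma>) d
      = real (card d) * (real (card d) - 1) / 2 / m - (real (card d) * (n - 1) / (2 * m))\<^sup>2"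
    if "d \<subseteq> g" for d
  proof -
    have "(\<Sum>v\<in>d. degree (cliques \<Gamma>) v) = card d * (card g - 1)"
      using that degree_cliques[OF \<Gamma> g] by (simp add: subset_iff)
    then show ?thesis
      using kn card_edges_cliques_within[OF \<Gamma> g that]
      by (simp add: cluster_score_def real_choose_two n_def m_def of_nat_diff)
  qed
  have "card {e \<in> edges (cliques \<Gamma>). e \<subseteq> g} \<le> card (edges (cliques \<Gamma>))"
    using network_cliques[OF \<Gamma>(1)] by (intro card_mono network_finite_edges) auto
  then have "real (card g choose 2) \<le> m"
    using card_edges_cliques_within[OF \<Gamma> g subset_refl] by (simp add: m_def)
  then have m: "n * (n - 1) \<le> 2 * m"
    by (simp add: real_choose_two n_def)
  have lt: "(n - 1)\<^sup>2 < 2 * m"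
    using m kn by (simp add: power2_eq_square algebra_simps)
  then have m0: "m > 0"
    by (smt (verit) zero_le_power2)
  \<comment> \<open>The gap between the proportional share of the block score and the score of the
    part factors, and each factor is positive.\<close>
  have "k * ((n * (n - 1) / 2 / m - (n * (n - 1) / (2 * m))\<^sup>2) / n)
      - (k * (k - 1) / 2 / m - (k * (n - 1) / (2 * m))\<^sup>2)
      = k * (n - k) * (2 * m - (n - 1)\<^sup>2) / (4 * m\<^sup>2)"
    using m0 kn by (simp add: field_simps power2_eq_square)
  moreover have "\<dots> > 0"
    using lt m0 kn by simp
  ultimately have "k * (k - 1) / 2 / m - (k * (n - 1) / (2 * m))\<^sup>2
      < k * ((n * (n - 1) / 2 / m - (n * (n - 1) / (2 * m))\<^sup>2) / n)"
    by linarith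
  with c show ?thesis
    by (simp add: score k_def n_def psubset_eq)
qed

lemma admissible_cliques:
  assumes "partition_on (\<Union>\<Gamma>) \<Gamma>"
  shows "admissible (cliques \<Gamma>) \<Gamma>"
  unfolding admissible_def
proof (intro conjI ballI is_connected_clique)
  show "partition_on (verts (cliques \<Gamma>)) \<Gamma>"
    using assms by (simp add: cliques_def)
  show "{u, v} \<in> edges (cliques \<Gamma>)" if "c \<in> \<Gamma>" "u \<in> c" "v \<in> c" "u \<noteq> v" for c u v
    using that by (auto simp: cliques_def card_2_iff)
qed

text \<open>Each vertex is charged the average score of its block. A block earns exactly its charge,
  a proper part of a block earns strictly less, and the total charge is the same for
  \<open>\<C>\<close> and \<open>\<Gamma>\<close>.\<close>

lemma modularity_cliques_less:
  assumes \<Gamma>: "finite (\<Union>\<Gamma>)" "partition_on (\<Union>\<Gamma>) \<Gamma>"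
    and \<C>: "admissible (cliques \<Gamma>) \<C>" "\<C> \<noteq> \<Gamma>"
  shows "modularity (cliques \<Gamma>) \<C> < modularity (cliques \<Gamma>) \<Gamma>"
proof -
  let ?N = "cliques \<Gamma>"
  define w where "w v = (let g = THE g. g \<in> \<Gamma> \<and> v \<in> g in cluster_score ?N g / real (card g))" for v
  have part: "partition_on (\<Union>\<Gamma>) \<C>"
    using \<C>(1) by (simp add: admissible_def cliques_def)
  have the: "(THE g. g \<in> \<Gamma> \<and> v \<in> g) = g" if "g \<in> \<Gamma>" "v \<in> g" for g v
    using that \<Gamma>(2) by (intro the_equality) (auto simp: partition_on_def disjoint_def)
  have w: "sum w c = real (card c) * (cluster_score ?N g / real (card g))" if "g \<in> \<Gamma>" "c \<subseteq> g" for c g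
    using that by (simp add: w_def the subset_iff)
  have fin: "finite g" if "g \<in> \<Gamma>" for g
    using that \<Gamma>(1) by (auto intro: finite_subset)
  have w_eq: "sum w g = cluster_score ?N g" if "g \<in> \<Gamma>" for g
    using w[OF that subset_refl] fin[OF that] \<Gamma>(2) that
    by (cases "g = {}") (auto simp: partition_on_def)
  have less: "cluster_score ?N c < sum w c" if c: "c \<in> \<C>" "c \<notin> \<Gamma>" for c
  proof -
    obtain g where g: "g \<in> \<Gamma>" "c \<subseteq> g"
      using admissible_cliques_refines[OF \<Gamma>(2) \<C>(1) c(1)] by blast
    moreover have "c \<noteq> {}" "c \<subset> g"
      using c g part by (auto simp: partition_on_def)
    ultimately show ?thesis
      using cluster_score_part_of_clique[OF \<Gamma>] w by metis
  qed
  obtain c where c: "c \<in> \<C>" "c \<notin> \<Gamma>"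
  proof -
    \<comment> \<open>Of two partitions of the same set, one cannot be a proper subset of the
      other.\<close>
    have "\<not> \<C> \<subseteq> \<Gamma>"
    proof
      assume sub: "\<C> \<subseteq> \<Gamma>"
      have "g \<in> \<C>" if g: "g \<in> \<Gamma>" for g
      proof -
        obtain v where v: "v \<in> g"
          using g \<Gamma>(2) by (metis all_not_in_conv partition_onD3)
        then obtain c where "c \<in> \<C>" "v \<in> c"
          using g part by (auto simp: partition_on_def)
        moreover from this have "c = g"
          using sub g v \<Gamma>(2) by (auto simp: partition_on_def disjoint_def)
        ultimately show ?thesis
          by simp
      qed
      with sub \<C>(2) show False
        by blast
    qed
    with that show ?thesis
      by blast
  qed
  have "modularity ?N \<C> < (\<Sum>c\<in>\<C>. sum w c)"
    unfolding modularity_cluster_score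
  proof (rule sum_strict_mono_ex1)
    show "finite \<C>"
      using \<Gamma>(1) part by (metis finite_UnionD partition_onD1)
    show "\<forall>c\<in>\<C>. cluster_score ?N c \<le> sum w c"
      using less w_eq by (metis less_eq_real_def order_refl)
    show "\<exists>c\<in>\<C>. cluster_score ?N c < sum w c"
      using c less by blast
  qed
  also have "\<dots> = (\<Sum>g\<in>\<Gamma>. sum w g)"
    by (simp only: sum.partition[OF \<Gamma>(1) part, symmetric] sum.partition[OF \<Gamma>, symmetric])
  also have "\<dots> = modularity ?N \<Gamma>"
    by (simp add: modularity_cluster_score w_eq)
  finally show ?thesis .
qed

lemma richness_modularity_opt: "richness (modularity_opt :: 'a network \<Rightarrow> 'a set set set)"
  unfolding richness_def
proof (intro allI impI)
  fix V :: "'a set" and \<Gamma> assume "finite V \<and> partition_on V \<Gamma>"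
  moreover from this have V: "V = \<Union>\<Gamma>"
    by (simp add: partition_on_def)
  ultimately have \<Gamma>: "finite (\<Union>\<Gamma>)" "partition_on (\<Union>\<Gamma>) \<Gamma>"
    by auto
  have "modularity_opt (cliques \<Gamma>) = {\<Gamma>}"
    using modularity_cliques_less[OF \<Gamma>] admissible_cliques[OF \<Gamma>(2)]
    by (force simp: modularity_opt_def)
  with network_cliques[OF \<Gamma>(1)] show "\<exists>E. network (V, E) \<and> modularity_opt (V, E) = {\<Gamma>}"
    unfolding V cliques_def by blast
qed


section \<open>Consistency\<close>

definition hexagon :: "nat network" where
  "hexagon = ({0, 1, 2, 3, 4, 5}, {{0, 1}, {1, 2}, {2, 3}, {3, 4}, {4, 5}, {5, 0}})"

definition hexagon_path :: "nat network" where
  "hexagon_path = ({0, 1, 2, 3, 4, 5}, {{0, 1}, {1, 2}, {2, 3}, {3, 4}, {4, 5}})"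

definition hexagon_pairs :: "nat set set" where
  "hexagon_pairs = {{0, 1}, {2, 3}, {4, 5}}"

lemma network_hexagon: "network hexagon"
  by (auto simp: network_def hexagon_def)

lemma network_hexagon_path: "network hexagon_path"
  by (auto simp: network_def hexagon_path_def)

text \<open>A cluster of \<open>k\<close> vertices, \<open>0 < k < 6\<close>, spans at most
  \<open>k - 1\<close> edges, so the claim reduces to \<open>(k - 2) * (k - 3) \<ge> 0\<close>,
  which holds for integers; \<open>k = 0\<close> and \<open>k = 6\<close> score \<open>0\<close>.
  The weight is attained by paths of two or three vertices. The proof checks all subsets.\<close>

lemma cluster_score_hexagon_le:
  assumes "c \<subseteq> verts hexagon"
  shows "cluster_score hexagon c \<le> (\<Sum>v\<in>c. 1 / 36)"
proof -
  have "(\<Sum>v\<in>c. 1 / 36) = (\<Sum>v\<in>verts hexagon. of_bool (v \<in> c) / (36 :: real))"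
    using assms by (intro sum.mono_neutral_cong_left) (auto simp: hexagon_def)
  then show ?thesis
    unfolding cluster_score_of_bool[OF network_hexagon assms]
    by (cases "0 \<in> c"; cases "1 \<in> c"; cases "2 \<in> c"; cases "3 \<in> c"; cases "4 \<in> c"; cases "5 \<in> c")
      (simp_all add: hexagon_def graph_score_simps)
qed

text \<open>The weights total \<open>1 / 6\<close>, and three pairs scoring
  \<open>1 / 6 - (4 / 12)^2 = 1 / 18\<close> each attain this bound.\<close>

lemma hexagon_pairs_opt: "hexagon_pairs \<in> modularity_opt hexagon"
  unfolding modularity_opt_def mem_Collect_eq
proof (intro conjI allI impI)
  show "admissible hexagon hexagon_pairs"
    unfolding admissible_def
  proof (intro conjI ballI is_connected_clique)
    show "partition_on (verts hexagon) hexagon_pairs"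
      by (auto simp: partition_on_def disjoint_def hexagon_def hexagon_pairs_def)
    show "{u, v} \<in> edges hexagon" if "c \<in> hexagon_pairs" "u \<in> c" "v \<in> c" "u \<noteq> v" for c u v
      using that by (auto simp: hexagon_def hexagon_pairs_def insert_commute)
  qed
next
  fix \<D> assume "admissible hexagon \<D>"
  then have part: "partition_on (verts hexagon) \<D>"
    by (simp add: admissible_def)
  have "modularity hexagon \<D> \<le> (\<Sum>v\<in>verts hexagon. 1 / 36)"
    using part network_hexagon by (intro modularity_le_sum_weights cluster_score_hexagon_le)
      (auto simp: network_def partition_on_def)
  also have "\<dots> = 1 / 6"
    by (simp add: hexagon_def)
  finally have le: "modularity hexagon \<D> \<le> 1 / 6" .
  have "cluster_score hexagon c = 1 / 18" if "c \<in> hexagon_pairs" for c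
  proof -
    have "c \<subseteq> verts hexagon"
      using that by (auto simp: hexagon_def hexagon_pairs_def)
    from cluster_score_of_bool[OF network_hexagon this] that show ?thesis
      unfolding hexagon_pairs_def by (elim insertE) (simp_all add: hexagon_def graph_score_simps)
  qed
  then have "modularity hexagon hexagon_pairs = (\<Sum>c\<in>hexagon_pairs. 1 / 18)"
    unfolding modularity_cluster_score by (rule sum.cong[OF refl])
  also have "\<dots> = 1 / 6"
    by (simp add: hexagon_pairs_def doubleton_eq_iff)
  finally have "modularity hexagon hexagon_pairs = 1 / 6" .
  with le show "modularity hexagon \<D> \<le> modularity hexagon hexagon_pairs"
    by simp
qed

lemma hexagon_path_opt_not_refining:
  assumes "\<C> \<in> modularity_opt hexagon_path"
  shows "\<not> (\<forall>c\<in>\<C>. \<exists>d\<in>hexagon_pairs. c \<subseteq> d)"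
proof
  assume ref: "\<forall>c\<in>\<C>. \<exists>d\<in>hexagon_pairs. c \<subseteq> d"
  let ?halves = "{{0, 1, 2}, {3, 4, 5}} :: nat set set"
  \<comment> \<open>Each vertex gets half the score of its pair: \<open>11 / 100\<close> for the two
    end pairs, \<open>4 / 100\<close> for the middle one.\<close>
  define w :: "nat \<Rightarrow> real" where "w v = (if v \<in> {2, 3} then 2 / 100 else 11 / 200)" for v
  have part: "partition_on (verts hexagon_path) \<C>"
    using assms by (simp add: modularity_opt_def admissible_def)
  have "is_connected (induced hexagon_path {0, 1, 2})"
  proof (rule is_connectedI[of _ 1])
    show "(1, v) \<in> reach (induced hexagon_path {0, 1, 2})"
      if "v \<in> verts (induced hexagon_path {0, 1, 2})" for v
      using that by (auto simp: induced_def hexagon_path_def insert_commute intro: reach_refl reach_edge)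
  qed
  moreover have "is_connected (induced hexagon_path {3, 4, 5})"
  proof (rule is_connectedI[of _ 4])
    show "(4, v) \<in> reach (induced hexagon_path {3, 4, 5})"
      if "v \<in> verts (induced hexagon_path {3, 4, 5})" for v
      using that by (auto simp: induced_def hexagon_path_def insert_commute intro: reach_refl reach_edge)
  qed
  ultimately have "admissible hexagon_path ?halves"
    by (auto simp: admissible_def partition_on_def disjoint_def hexagon_path_def)
  with assms have "modularity hexagon_path ?halves \<le> modularity hexagon_path \<C>"
    by (simp add: modularity_opt_def)
  also have "\<dots> \<le> sum w (verts hexagon_path)"
  proof (rule modularity_le_sum_weights[OF _ part])
    fix c assume c: "c \<in> \<C>"
    have sub: "c \<subseteq> verts hexagon_path"
      using part c by (auto simp: partition_on_def)
    have "sum w c = (\<Sum>v\<in>verts hexagon_path. of_bool (v \<in> c) * w v)"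
      using sub by (intro sum.mono_neutral_cong_left) (auto simp: hexagon_path_def)
    note eqs = cluster_score_of_bool[OF network_hexagon_path sub] this
    \<comment> \<open>Refinement leaves only two memberships open in each case. Single vertices have
      negative scores, so only whole pairs make the bound tight.\<close>
    have "c \<subseteq> {0, 1} \<or> c \<subseteq> {2, 3} \<or> c \<subseteq> {4, 5}"
      using ref c unfolding hexagon_pairs_def by blast
    then show "cluster_score hexagon_path c \<le> sum w c"
    proof (elim disjE)
      assume "c \<subseteq> {0, 1}"
      then have "2 \<notin> c" "3 \<notin> c" "4 \<notin> c" "5 \<notin> c"
        by auto
      then show ?thesis
        unfolding eqs by (cases "0 \<in> c"; cases "1 \<in> c")
          (simp_all add: hexagon_path_def w_def graph_score_simps)
    next
      assume "c \<subseteq> {2, 3}"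
      then have "0 \<notin> c" "1 \<notin> c" "4 \<notin> c" "5 \<notin> c"
        by auto
      then show ?thesis
        unfolding eqs by (cases "2 \<in> c"; cases "3 \<in> c")
          (simp_all add: hexagon_path_def w_def graph_score_simps)
    next
      assume "c \<subseteq> {4, 5}"
      then have "0 \<notin> c" "1 \<notin> c" "2 \<notin> c" "3 \<notin> c"
        by auto
      then show ?thesis
        unfolding eqs by (cases "4 \<in> c"; cases "5 \<in> c")
          (simp_all add: hexagon_path_def w_def graph_score_simps)
    qed
  qed (simp add: hexagon_path_def)
  also have "\<dots> = 26 / 100"
    by (simp add: hexagon_path_def w_def)
  finally have le: "modularity hexagon_path ?halves \<le> 26 / 100" .
  have "cluster_score hexagon_path c = 15 / 100" if "c \<in> ?halves" for c
  proof -
    have "c \<subseteq> verts hexagon_path"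
      using that by (auto simp: hexagon_path_def)
    from cluster_score_of_bool[OF network_hexagon_path this] that show ?thesis
      by (elim insertE) (simp_all add: hexagon_path_def graph_score_simps)
  qed
  then have "modularity hexagon_path ?halves = (\<Sum>c\<in>?halves. 15 / 100)"
    unfolding modularity_cluster_score by (rule sum.cong[OF refl])
  \<comment> \<open>Distinctness makes the sum over the set of halves have two terms, giving
    \<open>3 / 10\<close>.\<close>
  moreover have "{0, 1, 2} \<noteq> {3, 4, 5 :: nat}"
    by auto
  ultimately show False
    using le by simp
qed

lemma inter_edgeI:
  "c \<in> \<Gamma> \<Longrightarrow> d \<in> \<Gamma> \<Longrightarrow> c \<noteq> d \<Longrightarrow> u \<in> c \<Longrightarrow> v \<in> d \<Longrightarrow> inter_edge \<Gamma> {u, v}"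
  unfolding inter_edge_def by blast

lemma inter_edge_deletion_hexagon_path: "inter_edge_deletion hexagon_pairs hexagon hexagon_path"
proof -
  have "inter_edge hexagon_pairs {5, 0}"
    by (rule inter_edgeI[of "{4, 5}" _ "{0, 1}"]) (simp_all add: hexagon_pairs_def doubleton_eq_iff)
  then have "{{5, 0}} \<subseteq> {e \<in> edges hexagon. inter_edge hexagon_pairs e}"
    by (simp add: hexagon_def)
  moreover have "verts hexagon_path = verts hexagon" "edges hexagon_path = edges hexagon - {{5, 0}}"
    by (simp_all add: hexagon_def hexagon_path_def insert_Diff_if doubleton_eq_iff)
  ultimately show ?thesis
    unfolding inter_edge_deletion_def by blast
qed

text \<open>With no added edges a consistent modification is a mere deletion, so one counterexample
  serves all three consistency axioms.\<close>

lemma inter_edge_deletion_consistent: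
  assumes "inter_edge_deletion \<Gamma> N N'"
  shows "consistent_modification \<Gamma> N N'"
proof -
  obtain D where "verts N' = verts N" "D \<subseteq> {e \<in> edges N. inter_edge \<Gamma> e}" "edges N' = edges N - D"
    using assms by (auto simp: inter_edge_deletion_def)
  then show ?thesis
    unfolding consistent_modification_def by (intro conjI exI[of _ D] exI[of _ "{}"]) auto
qed

text \<open>The partition into pairs refines itself.\<close>

lemma hexagon_pairs_not_opt: "hexagon_pairs \<notin> modularity_opt hexagon_path"
  using hexagon_path_opt_not_refining by blast

lemma not_inter_edge_consistency:
  "\<not> inter_edge_consistency (modularity_opt :: nat network \<Rightarrow> nat set set set)"
  using network_hexagon hexagon_pairs_opt inter_edge_deletion_hexagon_path hexagon_pairs_not_opt
  unfolding inter_edge_consistency_def by blast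

lemma not_standard_consistency:
  "\<not> standard_consistency (modularity_opt :: nat network \<Rightarrow> nat set set set)"
  using network_hexagon hexagon_pairs_opt hexagon_pairs_not_opt
    inter_edge_deletion_consistent[OF inter_edge_deletion_hexagon_path]
  unfolding standard_consistency_def by blast

lemma not_refinement_consistency:
  "\<not> refinement_consistency (modularity_opt :: nat network \<Rightarrow> nat set set set)"
  using network_hexagon hexagon_pairs_opt hexagon_path_opt_not_refining
    inter_edge_deletion_consistent[OF inter_edge_deletion_hexagon_path]
  unfolding refinement_consistency_def by blast


section \<open>The resolution limit\<close>

text \<open>Partitions of a finite set are finitely many, and the one into singletons is admissible.
  The later counterexamples start from some optimum without determining it completely, so its
  existence is needed.\<close>

lemma modularity_opt_nonempty:
  assumes "network N"
  shows "modularity_opt N \<noteq> {}"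
proof -
  define S where "S = modularity N ` {\<C>. admissible N \<C>}"
  have "finite {\<C>. admissible N \<C>}"
    by (rule finite_subset[OF _ finitely_many_partition_on[of "verts N"]])
      (use assms in \<open>auto simp: admissible_def network_def\<close>)
  then have fin: "finite S"
    by (simp add: S_def)
  have "is_connected (induced N {v})" for v
    by (rule is_connected_clique) auto
  then have "admissible N ((\<lambda>v. {v}) ` verts N)"
    by (auto simp: admissible_def partition_on_def disjoint_def)
  then have "Max S \<in> S"
    using fin by (intro Max_in) (auto simp: S_def)
  then obtain \<C> where \<C>: "admissible N \<C>" "modularity N \<C> = Max S"
    by (auto simp: S_def)
  have "modularity N \<D> \<le> modularity N \<C>" if "admissible N \<D>" for \<D>
    using that fin by (simp add: \<C>(2) S_def)
  with \<C>(1) show ?thesis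
    by (auto simp: modularity_opt_def)
qed

section \<open>Merging adjacent clusters\<close>

text \<open>The edge \<open>{u, v}\<close> is counted only in the union, a gain of at least
  \<open>1 / m\<close>. The cross term of the squared degree sum costs
  \<open>D c * D d / (2 * m * m)\<close>, which \<open>lt\<close> keeps below
  \<open>1 / m\<close>.\<close>

lemma cluster_score_merge_less:
  assumes N: "network N" and sub: "c \<subseteq> verts N" "d \<subseteq> verts N" and disj: "c \<inter> d = {}"
    and e: "{u, v} \<in> edges N" "u \<in> c" "v \<in> d"
    and lt: "(\<Sum>v\<in>c. degree N v) * (\<Sum>v\<in>d. degree N v) < 2 * card (edges N)"
  shows "cluster_score N c + cluster_score N d < cluster_score N (c \<union> d)"
proof -
  define E where "E c = {e \<in> edges N. e \<subseteq> c}" for c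
  define D where "D c = real (\<Sum>v\<in>c. degree N v)" for c
  define m where "m = real (card (edges N))"
  have fin: "finite (edges N)" "finite c" "finite d" "finite (E c)" "finite (E d)" "finite (E (c \<union> d))"
    using N sub by (auto simp: network_finite_edges network_def E_def intro: finite_subset)
  have "E c \<inter> E d = {}"
  proof -
    have "e \<subseteq> {}" "card e = 2" if "e \<in> E c \<inter> E d" for e
      using that N disj by (auto simp: E_def network_def)
    then show ?thesis
      by (metis all_not_in_conv card.empty subset_empty zero_neq_numeral)
  qed
  moreover have "{u, v} \<notin> E c \<union> E d"
    using e disj by (auto simp: E_def)
  ultimately have "card (insert {u, v} (E c \<union> E d)) = card (E c) + card (E d) + 1"
    using fin by (simp add: card_Un_disjoint)
  moreover have "card (insert {u, v} (E c \<union> E d)) \<le> card (E (c \<union> d))"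
    using e fin by (intro card_mono) (auto simp: E_def)
  ultimately have E: "real (card (E c)) + real (card (E d)) + 1 \<le> real (card (E (c \<union> d)))"
    by linarith
  have D: "D (c \<union> d) = D c + D d"
    using fin disj by (simp add: D_def sum.union_disjoint)
  have "real ((\<Sum>v\<in>c. degree N v) * (\<Sum>v\<in>d. degree N v)) < real (2 * card (edges N))"
    using lt by (simp only: of_nat_less_iff)
  then have lt': "D c * D d < 2 * m"
    by (simp add: D_def m_def)
  have m: "m > 0"
    using e fin by (auto simp: m_def card_gt_0_iff)
  have "real (card (E c)) / m + real (card (E d)) / m + 1 / m \<le> real (card (E (c \<union> d))) / m"
    using divide_right_mono[OF E, of m] m by (simp add: add_divide_distrib)
  moreover have "((D c + D d) / (2 * m))\<^sup>2 = (D c / (2 * m))\<^sup>2 + (D d / (2 * m))\<^sup>2 + D c * D d / (2 * m * m)"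
    using m by (simp add: field_simps power2_eq_square)
  moreover have "D c * D d / (2 * m * m) < 1 / m"
    using m lt' by (simp add: field_simps)
  ultimately show ?thesis
    unfolding cluster_score_def E_def[symmetric] D_def[symmetric] m_def[symmetric] D by linarith
qed

lemma is_connected_union:
  assumes "is_connected (induced N c)" "is_connected (induced N d)"
    and "{u, v} \<in> edges N" "u \<in> c" "v \<in> d"
  shows "is_connected (induced N (c \<union> d))"
proof (rule is_connectedI[of _ u])
  fix x assume "x \<in> verts (induced N (c \<union> d))"
  then consider "x \<in> c" | "x \<in> d"
    by (auto simp: induced_def)
  then show "(u, x) \<in> reach (induced N (c \<union> d))"
  proof cases
    case 1
    then have "(u, x) \<in> reach (induced N c)"
      using assms by (auto simp: is_connected_def induced_def)
    then show ?thesis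
      by (rule reach_mono[rotated]) (auto simp: induced_def)
  next
    case 2
    then have "(v, x) \<in> reach (induced N d)"
      using assms by (auto simp: is_connected_def induced_def)
    then have "(v, x) \<in> reach (induced N (c \<union> d))"
      by (rule reach_mono[rotated]) (auto simp: induced_def)
    moreover have "(u, v) \<in> reach (induced N (c \<union> d))"
      using assms by (intro reach_edge) (auto simp: induced_def)
    ultimately show ?thesis
      by (blast intro: reach_trans)
  qed
qed

text \<open>Otherwise replacing \<open>c\<close> and \<open>d\<close> by their union, connected
  through \<open>{u, v}\<close>, would raise the score of an optimum.\<close>

lemma modularity_opt_adjacent_clusters:
  assumes N: "network N" and \<Gamma>: "\<Gamma> \<in> modularity_opt N"
    and cd: "c \<in> \<Gamma>" "d \<in> \<Gamma>" "c \<noteq> d" and e: "{u, v} \<in> edges N" "u \<in> c" "v \<in> d"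
  shows "2 * card (edges N) \<le> (\<Sum>v\<in>c. degree N v) * (\<Sum>v\<in>d. degree N v)"
proof (rule ccontr)
  assume "\<not> ?thesis"
  then have lt: "(\<Sum>v\<in>c. degree N v) * (\<Sum>v\<in>d. degree N v) < 2 * card (edges N)"
    by simp
  define \<D> where "\<D> = insert (c \<union> d) (\<Gamma> - {c, d})"
  have adm: "admissible N \<Gamma>"
    using \<Gamma> by (simp add: modularity_opt_def)
  then have part: "partition_on (verts N) \<Gamma>"
    by (simp add: admissible_def)
  have disj: "x \<inter> y = {}" if "x \<in> \<Gamma>" "y \<in> \<Gamma>" "x \<noteq> y" for x y
    using part that by (auto simp: partition_on_def disjoint_def)
  have fin: "finite \<Gamma>"
    using part N by (auto simp: network_def intro: finite_elements)
  have "partition_on (verts N) \<D>"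
    unfolding partition_on_def
  proof (intro conjI)
    show "\<Union>\<D> = verts N"
      using part cd by (auto simp: \<D>_def partition_on_def)
    show "disjoint \<D>"
      unfolding disjoint_def \<D>_def using disj cd by blast
    show "{} \<notin> \<D>"
      using part e by (auto simp: \<D>_def partition_on_def)
  qed
  moreover have "is_connected (induced N (c \<union> d))"
    using adm cd e by (intro is_connected_union) (auto simp: admissible_def)
  ultimately have "admissible N \<D>"
    using adm by (auto simp: admissible_def \<D>_def)
  then have "modularity N \<D> \<le> modularity N \<Gamma>"
    using \<Gamma> by (simp add: modularity_opt_def)
  \<comment> \<open>The union meets \<open>c\<close>, so it cannot be another cluster; inserting it
    therefore adds a genuinely new summand.\<close>
  moreover have "c \<union> d \<notin> \<Gamma> - {c, d}"
    using disj[of "c \<union> d" c] cd e by blast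
  then have "modularity N \<D> = cluster_score N (c \<union> d) + (\<Sum>x\<in>\<Gamma> - {c, d}. cluster_score N x)"
    using fin by (simp add: modularity_cluster_score \<D>_def)
  moreover have "\<Gamma> = insert c (insert d (\<Gamma> - {c, d}))"
    using cd by blast
  then have "modularity N \<Gamma>
      = cluster_score N c + (cluster_score N d + (\<Sum>x\<in>\<Gamma> - {c, d}. cluster_score N x))"
    unfolding modularity_cluster_score using fin cd(3)
    by (metis (no_types, lifting) DiffD2 finite_Diff finite_insert insertCI insertE sum.insert)
  moreover have "cluster_score N c + cluster_score N d < cluster_score N (c \<union> d)"
    using part disj[OF cd] cd
    by (intro cluster_score_merge_less[OF N _ _ _ e lt]) (auto simp: partition_on_def)
  ultimately show False
    by linarith
qed

text \<open>Connected clusters that meet \<open>K\<close> stay inside \<open>K\<close>. An edge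
  between two of them would give a product of degree sums of at least
  \<open>2 * card (edges N)\<close>, yet each factor is at most the degree sum of
  \<open>K\<close>.\<close>

lemma modularity_opt_small_component:
  assumes N: "network N" and \<Gamma>: "\<Gamma> \<in> modularity_opt N" and K: "K \<in> components N"
    and small: "(\<Sum>v\<in>K. degree N v)\<^sup>2 < 2 * card (edges N)"
  shows "K \<in> \<Gamma>"
proof -
  obtain r where r: "r \<in> verts N" "K = {v \<in> verts N. (r, v) \<in> reach N}"
    using K by (auto simp: components_def)
  have part: "partition_on (verts N) \<Gamma>"
    and conn: "\<And>c. c \<in> \<Gamma> \<Longrightarrow> is_connected (induced N c)"
    using \<Gamma> by (auto simp: modularity_opt_def admissible_def)
  have within: "c \<subseteq> K" if c: "c \<in> \<Gamma>" "x \<in> c" "x \<in> K" for c x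
  proof
    fix y assume "y \<in> c"
    with c conn have "(x, y) \<in> reach (induced N c)"
      by (auto simp: is_connected_def induced_def)
    then have "(x, y) \<in> reach N"
      by (rule reach_mono[rotated]) (auto simp: induced_def)
    with c r \<open>y \<in> c\<close> part show "y \<in> K"
      by (auto simp: partition_on_def intro: reach_trans)
  qed
  have rK: "r \<in> K"
    using r by (simp add: reach_refl)
  obtain c where c: "c \<in> \<Gamma>" "r \<in> c"
    using r(1) part by (auto simp: partition_on_def)
  \<comment> \<open>Without outgoing edges the cluster of the root \<open>r\<close> contains
    everything reachable from \<open>r\<close>, hence all of \<open>K\<close>.\<close>
  have closed: "y \<in> c" if e: "{x, y} \<in> edges N" "x \<in> c" for x y
  proof (rule ccontr)
    assume "y \<notin> c"
    have "y \<in> verts N"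
      using e N by (auto simp: network_def)
    then obtain d where d: "d \<in> \<Gamma>" "y \<in> d"
      using part by (auto simp: partition_on_def)
    have cK: "c \<subseteq> K"
      using within c rK by blast
    with e \<open>y \<in> verts N\<close> r have "y \<in> K"
      by (auto intro: reach_trans reach_edge)
    then have dK: "d \<subseteq> K"
      using within d by blast
    have finK: "finite K"
      using N r by (simp add: network_def)
    have "2 * card (edges N) \<le> (\<Sum>v\<in>c. degree N v) * (\<Sum>v\<in>d. degree N v)"
      using \<open>y \<notin> c\<close> d by (intro modularity_opt_adjacent_clusters[OF N \<Gamma> c(1) d(1) _ e d(2)]) auto
    also have "\<dots> \<le> (\<Sum>v\<in>K. degree N v) * (\<Sum>v\<in>K. degree N v)"
      using cK dK finK by (intro mult_le_mono sum_mono2) auto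
    finally show False
      using small by (simp add: power2_eq_square)
  qed
  have "y \<in> c" if "y \<in> K" for y
  proof (rule reach_closed)
    show "(r, y) \<in> reach N"
      using that r(2) by simp
  qed (fact c closed)+
  with within[OF c rK] have "K = c"
    by blast
  with c show ?thesis
    by simp
qed

section \<open>A pair of cliques beside a large star\<close>

text \<open>The star with \<open>(2 n)\<^sup>4\<close> leaves provides enough edges for the resolution limit to exceed the
  size of the pair of cliques.\<close>

definition clique_pair_edges :: "nat \<Rightarrow> nat set set" where
  "clique_pair_edges n = {e. e \<subseteq> {..<n} \<and> card e = 2} \<union> {e. e \<subseteq> {n..<2 * n} \<and> card e = 2} \<union> {{0, n}}"

text \<open>The centre \<open>2 * n\<close> and the leaves beyond it avoid the cliques, which thus
  form a component of their own.\<close>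

definition clique_pair_star :: "nat \<Rightarrow> nat network" where
  "clique_pair_star n =
     ({..2 * n + (2 * n) ^ 4}, clique_pair_edges n \<union> (\<lambda>j. {2 * n, j}) ` {2 * n<..2 * n + (2 * n) ^ 4})"

lemma clique_pair_edgesI:
  "u < n \<Longrightarrow> v < n \<Longrightarrow> u \<noteq> v \<Longrightarrow> {u, v} \<in> clique_pair_edges n"
  "n \<le> u \<Longrightarrow> u < 2 * n \<Longrightarrow> n \<le> v \<Longrightarrow> v < 2 * n \<Longrightarrow> u \<noteq> v \<Longrightarrow> {u, v} \<in> clique_pair_edges n"
  "{0, n} \<in> clique_pair_edges n"
  by (simp_all add: clique_pair_edges_def)

lemma clique_pair_edges_within: "n > 0 \<Longrightarrow> e \<in> clique_pair_edges n \<Longrightarrow> e \<subseteq> {..<2 * n}"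
  by (auto simp: clique_pair_edges_def)

text \<open>For \<open>n = 0\<close> the bridge \<open>{0, n}\<close> would collapse to a single
  vertex.\<close>

lemma network_clique_pair_star: "n > 0 \<Longrightarrow> network (clique_pair_star n)"
  by (force simp: network_def clique_pair_star_def clique_pair_edges_def)

lemma edges_clique_pair_star_within:
  assumes "n > 0"
  shows "{e \<in> edges (clique_pair_star n). e \<subseteq> {..<2 * n}} = clique_pair_edges n"
  using clique_pair_edges_within[OF assms] by (auto simp: clique_pair_star_def)

lemma component_clique_pair_star:
  assumes n: "n > 0"
  shows "{..<2 * n} \<in> components (clique_pair_star n)"
proof -
  let ?N = "clique_pair_star n"
  have reach: "(0, v) \<in> reach ?N" if v: "v < 2 * n" for v
  proof -
    have edge: "(u, v) \<in> reach ?N" if "{u, v} \<in> clique_pair_edges n" for u v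
      using that by (intro reach_edge) (simp add: clique_pair_star_def)
    have A: "(0, v) \<in> reach ?N" if "v < n" for v
      using that by (cases "v = 0") (simp_all add: reach_refl edge clique_pair_edgesI)
    have B: "(n, v) \<in> reach ?N" if "n \<le> v" "v < 2 * n" for v
      using that by (cases "v = n") (simp_all add: reach_refl edge clique_pair_edgesI)
    have "(0, n) \<in> reach ?N"
      by (intro edge clique_pair_edgesI)
    with A B v show ?thesis
      by (meson not_le reach_trans)
  qed
  have "v < 2 * n" if "(0, v) \<in> reach ?N" for v
  proof -
    have "v \<in> {..<2 * n}"
    proof (rule reach_closed[OF that])
      show "y \<in> {..<2 * n}" if "{x, y} \<in> edges ?N" "x \<in> {..<2 * n}" for x y
        using that clique_pair_edges_within[OF n, of "{x, y}"]
        by (auto simp: clique_pair_star_def doubleton_eq_iff)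
    qed (use n in auto)
    then show ?thesis
      by simp
  qed
  with reach have "{..<2 * n} = {v \<in> verts ?N. (0, v) \<in> reach ?N}"
    by (auto simp: clique_pair_star_def)
  then show ?thesis
    by (auto simp: components_def clique_pair_star_def)
qed

text \<open>Degrees in the component are at most \<open>2 * n\<close>, so its degree sum is at most
  \<open>(2 * n)^2\<close>, whose square \<open>(2 * n)^4\<close> is exactly the number of star
  edges.\<close>

lemma clique_pair_star_opt:
  assumes n: "n > 0" and \<Gamma>: "\<Gamma> \<in> modularity_opt (clique_pair_star n)"
  shows "{..<2 * n} \<in> \<Gamma>"
proof (rule modularity_opt_small_component[OF network_clique_pair_star[OF n] \<Gamma> component_clique_pair_star[OF n]])
  let ?N = "clique_pair_star n"
  have fin: "finite (edges ?N)"
    using network_clique_pair_star[OF n] by (rule network_finite_edges)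
  have "degree ?N v \<le> 2 * n" if v: "v < 2 * n" for v
  proof -
    have "{e \<in> edges ?N. v \<in> e} \<subseteq> (\<lambda>u. {v, u}) ` {..<2 * n}"
    proof
      fix e assume "e \<in> {e \<in> edges ?N. v \<in> e}"
      with v have e: "e \<in> clique_pair_edges n" "v \<in> e"
        by (auto simp: clique_pair_star_def)
      then have "card e = 2"
        using n by (auto simp: clique_pair_edges_def)
      with e(2) obtain u where "e = {v, u}"
        by (auto simp: card_2_iff)
      with clique_pair_edges_within[OF n e(1)] show "e \<in> (\<lambda>u. {v, u}) ` {..<2 * n}"
        by auto
    qed
    then have "degree ?N v \<le> card ((\<lambda>u. {v, u}) ` {..<2 * n})"
      unfolding degree_def by (rule card_mono[rotated]) simp
    also have "\<dots> \<le> 2 * n"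
      by (metis card_image_le card_lessThan finite_lessThan)
    finally show ?thesis .
  qed
  then have "(\<Sum>v<2 * n. degree ?N v) \<le> 2 * n * (2 * n)"
    using sum_bounded_above[of "{..<2 * n}" "degree ?N" "2 * n"] by simp
  then have "(\<Sum>v<2 * n. degree ?N v)\<^sup>2 \<le> (2 * n * (2 * n))\<^sup>2"
    by (rule power_mono) simp
  also have "\<dots> = (2 * n) ^ 4"
    by (simp add: power2_eq_square eval_nat_numeral)
  also have "\<dots> = card ((\<lambda>j. {2 * n, j}) ` {2 * n<..2 * n + (2 * n) ^ 4})"
    by (subst card_image) (auto simp: inj_on_def doubleton_eq_iff)
  also have "\<dots> \<le> card (edges ?N)"
    using fin by (intro card_mono) (auto simp: clique_pair_star_def)
  finally have "(\<Sum>v<2 * n. degree ?N v)\<^sup>2 \<le> card (edges ?N)" .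
  \<comment> \<open>A positive number of edges turns the bound by \<open>card (edges ?N)\<close>
    into a strict bound by its double.\<close>
  moreover have "card (edges ?N) > 0"
    using fin by (auto simp: card_gt_0_iff clique_pair_star_def clique_pair_edges_def)
  ultimately show "(\<Sum>v<2 * n. degree ?N v)\<^sup>2 < 2 * card (edges ?N)"
    by linarith
qed

lemma pair_of_cliques_clique_pair_star:
  assumes n: "n > 0"
  shows "pair_of_cliques (clique_pair_star n) {..<n} {n..<2 * n} n"
proof -
  let ?N = "clique_pair_star n"
  have "{..<n} \<union> {n..<2 * n} = {..<2 * n}"
    by auto
  moreover have "{e \<in> edges ?N. \<exists>u\<in>{..<n}. \<exists>v\<in>{n..<2 * n}. e = {u, v}} = {{0, n}}" (is "?L = _")
  proof (intro equalityI subsetI)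
    fix e assume "e \<in> ?L"
    then obtain u v where e: "e \<in> edges ?N" "e = {u, v}" "u < n" "n \<le> v" "v < 2 * n"
      by auto
    then have "e \<in> clique_pair_edges n"
      by (auto simp: clique_pair_star_def doubleton_eq_iff)
    \<comment> \<open>Having an endpoint on each side rules out both cliques and leaves the
      bridge.\<close>
    moreover have "\<not> e \<subseteq> {..<n}" "\<not> e \<subseteq> {n..<2 * n}"
      using e by auto
    ultimately show "e \<in> {{0, n}}"
      by (simp add: clique_pair_edges_def)
  next
    fix e assume e: "e \<in> {{0, n}}"
    have "0 \<in> {..<n}" "n \<in> {n..<2 * n}"
      using n by auto
    with e have "\<exists>u\<in>{..<n}. \<exists>v\<in>{n..<2 * n}. e = {u, v}"
      by blast
    with e show "e \<in> ?L"
      by (auto simp: clique_pair_star_def clique_pair_edgesI)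
  qed
  ultimately show ?thesis
    using component_clique_pair_star[OF n] unfolding pair_of_cliques_def
    by (auto simp: clique_pair_star_def clique_pair_edgesI)
qed

text \<open>The axiom would put \<open>{..<n}\<close> into an optimum that already contains the
  larger overlapping cluster \<open>{..<2 * n}\<close>.\<close>

lemma not_pair_of_cliques_axiom:
  "\<not> pair_of_cliques_axiom (modularity_opt :: nat network \<Rightarrow> nat set set set)"
proof
  assume "pair_of_cliques_axiom (modularity_opt :: nat network \<Rightarrow> nat set set set)"
  then obtain n\<^sub>0 where n\<^sub>0: "\<forall>N A B n. network N \<and> pair_of_cliques N A B n \<and> n\<^sub>0 \<le> 2 * n
      \<longrightarrow> (\<forall>\<Gamma>\<in>modularity_opt N. A \<in> \<Gamma> \<and> (B :: nat set) \<in> \<Gamma>)"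
    unfolding pair_of_cliques_axiom_def by (elim exE)
  define n where "n = Suc n\<^sub>0"
  have n: "n > 0" "2 * n \<ge> n\<^sub>0"
    by (auto simp: n_def)
  obtain \<Gamma> where \<Gamma>: "\<Gamma> \<in> modularity_opt (clique_pair_star n)"
    using modularity_opt_nonempty[OF network_clique_pair_star[OF n(1)]] by blast
  have "{..<n} \<in> \<Gamma>"
    using n\<^sub>0[rule_format, of "clique_pair_star n" "{..<n}" "{n..<2 * n}" n \<Gamma>] n \<Gamma>
      network_clique_pair_star pair_of_cliques_clique_pair_star by simp
  moreover have "{..<2 * n} \<in> \<Gamma>"
    by (rule clique_pair_star_opt[OF n(1) \<Gamma>])
  moreover have "disjoint \<Gamma>"
    using \<Gamma> by (simp add: modularity_opt_def admissible_def partition_on_def)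
  ultimately have "{..<n} = {..<2 * n} \<or> {..<n} \<inter> {..<2 * n} = {}"
    unfolding disjoint_def by blast
  moreover have "0 \<in> {..<n} \<inter> {..<2 * n}" "n \<in> {..<2 * n}" "n \<notin> {..<n}"
    using n by auto
  ultimately show False
    by (metis empty_iff)
qed

text \<open>Finiteness of the edge set makes the \<open>Min\<close> range over a finite set, where
  it is a lower bound.\<close>

lemma edge_connectivity_le:
  assumes "finite (edges N)" "F \<subseteq> edges N" "\<not> is_connected (verts N, edges N - F)"
  shows "edge_connectivity N \<le> card F"
  unfolding edge_connectivity_def using assms by (intro Min_le finite_imageI) auto

lemma edge_connectivity_clique_pair:
  assumes n: "n > 0"
  shows "edge_connectivity (induced (clique_pair_star n) {..<2 * n}) \<le> 1"
proof -
  let ?N = "induced (clique_pair_star n) {..<2 * n}"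
  have ind: "?N = ({..<2 * n}, clique_pair_edges n)"
    using edges_clique_pair_star_within[OF n] by (simp add: induced_def)
  have "(0, n) \<notin> reach (verts ?N, edges ?N - {{0, n}})"
  proof
    assume "(0, n) \<in> reach (verts ?N, edges ?N - {{0, n}})"
    \<comment> \<open>Once the bridge is removed, no edge leaves the first clique.\<close>
    then have "n \<in> {..<n}"
    proof (rule reach_closed)
      show "y \<in> {..<n}" if "{x, y} \<in> edges (verts ?N, edges ?N - {{0, n}})" "x \<in> {..<n}" for x y
        using that by (auto simp: ind clique_pair_edges_def)
    qed (use n in simp)
    then show False
      by simp
  qed
  moreover have "0 \<in> verts ?N" "n \<in> verts ?N"
    using n by (simp_all add: induced_def)
  ultimately have "\<not> is_connected (verts ?N, edges ?N - {{0, n}})"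
    unfolding is_connected_def by auto
  moreover have "finite (edges ?N)"
    by (rule finite_subset[OF _ network_finite_edges[OF network_clique_pair_star[OF n]]])
      (auto simp: induced_def)
  moreover have "{{0, n}} \<subseteq> edges ?N"
    by (auto simp: ind clique_pair_edges_def)
  ultimately show ?thesis
    using edge_connectivity_le[of ?N "{{0, n}}"] by simp
qed

text \<open>A function tending to infinity is eventually at least \<open>1\<close>, but clusters of
  arbitrarily large size \<open>2 * n\<close> have a bridge.\<close>

lemma not_connectivity:
  "\<not> connectivity (modularity_opt :: nat network \<Rightarrow> nat set set set)"
proof
  assume "connectivity (modularity_opt :: nat network \<Rightarrow> nat set set set)"
  then obtain f :: "real \<Rightarrow> real" where lim: "filterlim f at_top at_top"
    and f: "\<forall>N \<Gamma> c. network N \<and> \<Gamma> \<in> modularity_opt N \<and> (c :: nat set) \<in> \<Gamma> \<and> card c \<ge> 2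
      \<longrightarrow> f (real (card c)) < real (edge_connectivity (induced N c))"
    unfolding connectivity_def by (elim exE conjE)
  obtain x where x: "\<And>y. y \<ge> x \<Longrightarrow> f y \<ge> 1"
    using lim by (auto simp: filterlim_at_top eventually_at_top_linorder)
  \<comment> \<open>The successor keeps \<open>n\<close> positive even when \<open>x\<close> is
    negative, where \<open>nat\<close> returns \<open>0\<close>.\<close>
  define n where "n = Suc (nat \<lceil>x\<rceil>)"
  have n: "n > 0" "real (2 * n) \<ge> x"
    by (auto simp: n_def) linarith
  obtain \<Gamma> where \<Gamma>: "\<Gamma> \<in> modularity_opt (clique_pair_star n)"
    using modularity_opt_nonempty[OF network_clique_pair_star[OF n(1)]] by blast
  have "f (real (2 * n)) < real (edge_connectivity (induced (clique_pair_star n) {..<2 * n}))"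
    using f[rule_format, of "clique_pair_star n" \<Gamma> "{..<2 * n}"] \<Gamma> n(1)
      network_clique_pair_star clique_pair_star_opt by simp
  with edge_connectivity_clique_pair[OF n(1)] x[OF n(2)] show False
    by linarith
qed

text \<open>For \<open>n = 2\<close> the component is the path 1, 0, 2, 3, a single cluster beside
  the star. On its own, its halves score \<open>1 / 3 - (3 / 6)^2 = 1 / 12\<close> each, while the
  whole path scores \<open>0\<close>.\<close>

lemma not_fixed_point:
  "\<not> fixed_point (modularity_opt :: nat network \<Rightarrow> nat set set set)"
proof
  assume fp: "fixed_point (modularity_opt :: nat network \<Rightarrow> nat set set set)"
  let ?N = "clique_pair_star 2"
  let ?P = "({0, 1, 2, 3}, {{0, 1}, {2, 3}, {0, 2}}) :: nat network"
  have net: "network ?N"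
    by (rule network_clique_pair_star) simp
  obtain \<Gamma> where \<Gamma>: "\<Gamma> \<in> modularity_opt ?N"
    using modularity_opt_nonempty[OF net] by blast
  have four: "{..<2 * 2} = {0, 1, 2, 3 :: nat}"
    by auto
  have "{0, 1, 2, 3} \<in> \<Gamma>"
    using clique_pair_star_opt[OF _ \<Gamma>] unfolding four by simp
  then have opt: "{{0, 1, 2, 3}} \<in> modularity_opt (induced ?N {0, 1, 2, 3})"
    using fp[unfolded fixed_point_def, rule_format, of ?N \<Gamma> "{{0, 1, 2, 3}}"] net \<Gamma> by simp
  have "clique_pair_edges 2 = {{0, 1}, {2, 3}, {0, 2}}"
  proof -
    have "{e. e \<subseteq> {a, b} \<and> card e = 2} = {{a, b}}" if "a \<noteq> b" for a b :: nat
      using that by (auto simp: card_2_iff)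
    moreover have "{..<2} = {0, 1 :: nat}" "{2..<4} = {2, 3 :: nat}"
      by auto
    ultimately show ?thesis
      by (simp add: clique_pair_edges_def insert_commute)
  qed
  then have ind: "induced ?N {0, 1, 2, 3} = ?P"
    using edges_clique_pair_star_within[of 2] unfolding four by (simp add: induced_def)
  have P: "network ?P"
    by (auto simp: network_def)
  have "admissible ?P {{0, 1}, {2, 3}}"
    by (auto simp: admissible_def partition_on_def disjoint_def insert_commute intro!: is_connected_clique)
  then have "modularity ?P {{0, 1}, {2, 3}} \<le> modularity ?P {{0, 1, 2, 3}}"
    using opt unfolding ind by (simp add: modularity_opt_def)
  moreover have "cluster_score ?P {0, 1} = 1 / 12" "cluster_score ?P {2, 3} = 1 / 12"
    "cluster_score ?P {0, 1, 2, 3} = 0"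
    using cluster_score_of_bool[OF P, of "{0, 1}"] cluster_score_of_bool[OF P, of "{2, 3}"]
      cluster_score_of_bool[OF P, of "{0, 1, 2, 3}"]
    by (simp_all add: graph_score_simps)
  ultimately show False
    by (simp add: modularity_cluster_score doubleton_eq_iff)
qed

text \<open>Richness is constructed over any vertex type; the refutations fix \<open>nat\<close>,
  which has room for the arbitrarily large counterexamples.\<close>

theorem theorem4:
  shows "richness (modularity_opt :: 'a network \<Rightarrow> 'a set set set)
    \<and> \<not> standard_consistency (modularity_opt :: nat network \<Rightarrow> nat set set set)
    \<and> \<not> refinement_consistency (modularity_opt :: nat network \<Rightarrow> nat set set set)
    \<and> \<not> inter_edge_consistency (modularity_opt :: nat network \<Rightarrow> nat set set set)
    \<and> \<not> connectivity (modularity_opt :: nat network \<Rightarrow> nat set set set)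
    \<and> \<not> pair_of_cliques_axiom (modularity_opt :: nat network \<Rightarrow> nat set set set)
    \<and> \<not> fixed_point (modularity_opt :: nat network \<Rightarrow> nat set set set)"
  by (intro conjI richness_modularity_opt not_standard_consistency not_refinement_consistency
      not_inter_edge_consistency not_connectivity not_pair_of_cliques_axiom not_fixed_point)

end
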